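(* For every integer $K \geq 2$ there exist an edge weight function $h = h_K : S\times S \to [0,\infty)$, measurable and satisfying $c_1 d(x,y) \leq h(x,y) = h(y,x) \leq c_2 d(x,y)$ for all $x,y\in S$ for some positive constants $c_1,c_2$, a sequence of positive integers $n_l \to \infty$ as $l \to \infty$, and a constant $\epsilon_0 = \epsilon_0(K) > 0$ such that $$\mathbb{P}\left(\max_{1 \leq i \leq n_l} d\left(X_i,\mathcal{T}_{n_l},h\right) \geq K\right) \geq \epsilon_0$$ for all $l \geq 1$.
   Context: $S$ is the unit square in $\mathbb{R}^2$ and $d(x,y)$ is the Euclidean distance. $f$ is a fixed probability density on $S$ with $\epsilon_1 \leq \inf_{x\in S} f(x) \leq \sup_{x \in S} f(x) \leq \epsilon_2$ for constants $0<\epsilon_1\leq\epsilon_2<\infty$; $X_1,X_2,\ldots$ are i.i.d. with density $f$ on a probability space $(\Omega,\mathcal{F},\mathbb{P})$. $\alpha>0$ is a fixed constant (edge weight exponent). $K_n$ is the complete graph on the nodes $X_1,\ldots,X_n$, the edge $(X_i,X_j)$ having weight $h^{\alpha}(X_i,X_j) := (h(X_i,X_j))^{\alpha}$. The weight of a tree is the sum of the weights of its edges. $\mathcal{T}_n$ denotes the minimum spanning tree, i.e. a spanning tree of $K_n$ of minimum weight (if there are several, one is chosen by a deterministic rule). $d(X_i,\mathcal{T}_n,h)$ denotes the degree of the node $X_i$ in the minimum spanning tree $\mathcal{T}_n$ obtained with edge weight function $h$. All constants are independent of $n$ (they may depend on the fixed data $f,\epsilon_1,\epsilon_2,\alpha$).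 *)

theory Defs
  imports "HOL-Probability.Probability"
begin

definition unit_square :: "(real^2) set" where
  "unit_square = {x. \<forall>i. 0 \<le> x $ i \<and> x $ i \<le> 1}"

text \<open>
  The graphs below have vertex set \<open>{1..n}\<close>, the vertex \<open>i\<close> standing for the node \<open>x i\<close> (so that
  coinciding node positions cause no trouble); an edge is a two-element set of vertices, and a
  spanning subgraph is identified with its edge set.
\<close>

definition complete_edges :: "nat \<Rightarrow> nat set set" where
  "complete_edges n = {{i, j} | i j. i \<in> {1..n} \<and> j \<in> {1..n} \<and> i \<noteq> j}"

definition graph_connected :: "nat set \<Rightarrow> nat set set \<Rightarrow> bool" where
  "graph_connected V E \<longleftrightarrow> (\<forall>u\<in>V. \<forall>v\<in>V. (u, v) \<in> {(a, b). {a, b} \<in> E}\<^sup>*)"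

definition graph_cycle :: "nat set set \<Rightarrow> nat list \<Rightarrow> bool" where
  "graph_cycle E p \<longleftrightarrow> 3 \<le> length p \<and> distinct p \<and>
     (\<forall>k < length p. {p ! k, p ! (Suc k mod length p)} \<in> E)"

definition spanning_tree :: "nat \<Rightarrow> nat set set \<Rightarrow> bool" where
  "spanning_tree n E \<longleftrightarrow>
     E \<subseteq> complete_edges n \<and> graph_connected {1..n} E \<and> (\<nexists>p. graph_cycle E p)"

definition minimum_spanning_tree :: "(nat set \<Rightarrow> real) \<Rightarrow> nat \<Rightarrow> nat set set \<Rightarrow> bool" where
  "minimum_spanning_tree w n E \<longleftrightarrow>
     spanning_tree n E \<and> (\<forall>E'. spanning_tree n E' \<longrightarrow> (\<Sum>e\<in>E. w e) \<le> (\<Sum>e\<in>E'. w e))"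

definition node_degree :: "nat set set \<Rightarrow> nat \<Rightarrow> nat" where
  "node_degree E i = card {e \<in> E. i \<in> e}"

definition edge_weight_function :: "real \<Rightarrow> real \<Rightarrow> (real^2 \<Rightarrow> real^2 \<Rightarrow> real) \<Rightarrow> bool" where
  "edge_weight_function c1 c2 h \<longleftrightarrow>
     (\<lambda>(x, y). h x y) \<in> borel_measurable (restrict_space borel (unit_square \<times> unit_square)) \<and>
     (\<forall>x\<in>unit_square. \<forall>y\<in>unit_square.
        0 \<le> h x y \<and> c1 * dist x y \<le> h x y \<and> h x y = h y x \<and> h x y \<le> c2 * dist x y)"

text \<open>
  For an edge \<open>{i, j}\<close> this is \<open>h (x i) (x j) powr \<alpha>\<close>; as \<open>h\<close> is symmetric on the square, the order in
  which the two end points are passed to \<open>h\<close> is irrelevant.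
\<close>

definition edge_weight ::
    "real \<Rightarrow> (real^2 \<Rightarrow> real^2 \<Rightarrow> real) \<Rightarrow> (nat \<Rightarrow> real^2) \<Rightarrow> nat set \<Rightarrow> real" where
  "edge_weight \<alpha> h x e = h (x (Min e)) (x (Max e)) powr \<alpha>"

text \<open>
  A deterministic rule \<open>T\<close> that selects one minimum spanning tree \<open>T h n x\<close> from the edge weight
  function and the nodes \<open>x 1, \<dots>, x n\<close>. Ties may be broken in any way that depends measurably on
  the nodes, so that events about the selected tree have a probability.
\<close>

definition mst_rule ::
    "real \<Rightarrow> ((real^2 \<Rightarrow> real^2 \<Rightarrow> real) \<Rightarrow> nat \<Rightarrow> (nat \<Rightarrow> real^2) \<Rightarrow> nat set set) \<Rightarrow> bool" where
  "mst_rule \<alpha> T \<longleftrightarrow>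
     (\<forall>h c1 c2 n. 0 < c1 \<longrightarrow> 0 < c2 \<longrightarrow> edge_weight_function c1 c2 h \<longrightarrow> 1 \<le> n \<longrightarrow>
        (\<forall>x \<in> {1..n} \<rightarrow>\<^sub>E unit_square. minimum_spanning_tree (edge_weight \<alpha> h x) n (T h n x)) \<and>
        T h n \<in> measurable (PiM {1..n} (\<lambda>_. restrict_space borel unit_square)) (count_space UNIV))"

end

theory Submission
  imports Defs
begin

text \<open>
  The weight function. Colour a point by the side of the line \<open>x $ 1 = 1/2\<close> on which it lies, keep the
  Euclidean distance between points of the same colour, and shrink it by a small factor
  \<open>c = 1 / (8 * K)\<close> between points of different colours. The Euclidean bound on the degree of a minimum
  spanning tree comes from the fact that many points near a common centre must be close to each other;
  the shrinking removes this obstacle for a centre of one colour and surrounding points of the other.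

  The configuration. Suppose that, at some scale \<open>r\<close>, the window of half-width \<open>5 * r\<close> around
  the centre of the square contains exactly \<open>K + 1\<close> nodes: a hub on the left of the line and \<open>K\<close>
  leaves on the right of it, the leaves at mutual distance at least \<open>r / (2 * K)\<close> and all of them
  within \<open>3 * r\<close> of the hub. Then the hub is the strictly nearest node of each leaf: other leaves have
  the leaf's own colour and keep their distance, and nodes outside the window are too far away even if
  their distance is shrunk. An edge from a node to its strictly nearest neighbour lies in every
  minimum spanning tree, by the usual exchange argument (\<open>nearest_neighbour_edge_in_mst\<close>). So the hub
  has degree at least \<open>K\<close>, however ties are broken (\<open>hub_degree\<close>).

  The probability. Take \<open>n = (K + 1) * l\<close> nodes and \<open>r\<^sup>2\<close> proportional to \<open>1 / n\<close>, so that the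
  window contains a bounded number of nodes on average. Then each cell reserved for the hub or for a
  leaf is hit by a given node with probability of order \<open>1 / n\<close>, there are of order \<open>n\<close> nodes that
  could hit it, and the remaining nodes all miss the window with probability bounded away from zero
  (\<open>prob_one_point_per_cell\<close>). The bounds do not depend on \<open>l\<close>.
\<close>

section \<open>Edges that belong to every minimum spanning tree\<close>

text \<open>
  The remaining edges of the cycle are a detour from one end of the deleted edge to the other.
\<close>

lemma connected_delete_cycle_edge:
  assumes conn: "graph_connected V E" and cyc: "graph_cycle E p"
  shows "\<exists>e\<in>E. graph_connected V (E - {e})"
proof -
  let ?m = "length p"
  let ?e = "{p ! 0, p ! 1}"
  let ?R = "{(a, b). {a, b} \<in> E - {?e}}"
  have m: "3 \<le> ?m" and dist: "distinct p"
    and edge: "\<And>k. k < ?m \<Longrightarrow> {p ! k, p ! (Suc k mod ?m)} \<in> E"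
    using cyc by (auto simp: graph_cycle_def)
  have "0 < ?m" "Suc 0 mod ?m = 1" using m by auto
  then have e: "?e \<in> E" using edge[of 0] by simp
  have symR: "sym ?R" by (auto simp: sym_def insert_commute)
  have cycle_step: "(p ! k, p ! (Suc k mod ?m)) \<in> ?R" if "1 \<le> k" "k < ?m" for k
  proof -
    have "p ! k \<noteq> p ! 0" using that dist m by (subst nth_eq_iff_index_eq) auto
    moreover have "p ! k \<noteq> p ! 1 \<or> p ! (Suc k mod ?m) \<noteq> p ! 0"
    proof (cases "k = 1")
      case True
      have "Suc k mod ?m = 2" using True m by auto
      moreover have "p ! 2 \<noteq> p ! 0" using dist m by (subst nth_eq_iff_index_eq) auto
      ultimately show ?thesis by simp
    next
      case False
      then have "p ! k \<noteq> p ! 1" using that dist m by (subst nth_eq_iff_index_eq) auto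
      then show ?thesis by blast
    qed
    ultimately have "{p ! k, p ! (Suc k mod ?m)} \<noteq> ?e" by (auto simp: doubleton_eq_iff)
    then show ?thesis using edge[of k] that by auto
  qed
  \<comment> \<open>Follow the cycle from \<open>p ! 1\<close> the long way round, that is, without its first edge.\<close>
  have walk: "(p ! 1, p ! k) \<in> ?R\<^sup>*" if "1 \<le> k" "k < ?m" for k
    using that
  proof (induction k rule: dec_induct)
    case base show ?case by simp
  next
    case (step k)
    then have "(p ! k, p ! Suc k) \<in> ?R" using cycle_step[of k] by simp
    moreover have "(p ! 1, p ! k) \<in> ?R\<^sup>*" using step by simp
    ultimately show ?case by (rule rtrancl_into_rtrancl[rotated])
  qed
  have "(p ! (?m - 1), p ! 0) \<in> ?R" using cycle_step[of "?m - 1"] m by (cases ?m) auto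
  moreover have "(p ! 1, p ! (?m - 1)) \<in> ?R\<^sup>*" using m by (intro walk) auto
  ultimately have detour: "(p ! 1, p ! 0) \<in> ?R\<^sup>*" by (rule rtrancl_into_rtrancl[rotated])
  then have detour': "(p ! 0, p ! 1) \<in> ?R\<^sup>*"
    by (rule symD[OF sym_rtrancl[OF symR]])
  have "{(a, b). {a, b} \<in> E} \<subseteq> ?R\<^sup>*"
    using detour detour' by (auto simp: doubleton_eq_iff)
  then have "{(a, b). {a, b} \<in> E}\<^sup>* \<subseteq> ?R\<^sup>*" by (rule rtrancl_subset_rtrancl)
  then show ?thesis using conn e unfolding graph_connected_def by blast
qed

text \<open>
  Deleting cycle edges one after the other ends in a spanning tree. This relieves the exchange argument
  from showing that the exchanged graph is acyclic: connectedness is enough, since passing to a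
  spanning tree inside it does not increase a nonnegative weight.
\<close>

lemma connected_contains_spanning_tree:
  assumes "E \<subseteq> complete_edges n" and "graph_connected {1..n} E" and "finite E"
  shows "\<exists>F\<subseteq>E. spanning_tree n F"
  using assms(3,1,2)
proof (induction E rule: finite_psubset_induct)
  case (psubset E)
  show ?case
  proof (cases "\<exists>p. graph_cycle E p")
    case True
    then obtain e where "e \<in> E" "graph_connected {1..n} (E - {e})"
      using connected_delete_cycle_edge psubset.prems by blast
    then show ?thesis using psubset.IH[of "E - {e}"] psubset.prems by blast
  next
    case False
    then show ?thesis using psubset.prems by (auto simp: spanning_tree_def)
  qed
qed

lemma finite_complete_edges: "finite (complete_edges n)"
  by (rule finite_subset[of _ "Pow {1..n}"]) (auto simp: complete_edges_def)

text \<open>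
  The edge to be given up is the last one on a path from \<open>u\<close> to \<open>v\<close> that reaches \<open>v\<close> only at its end:
  the rest of this path, together with the new edge, still joins the two ends of the old edge.
\<close>

lemma connected_edge_exchange:
  assumes conn: "graph_connected V E" and "u \<in> V" "v \<in> V" "u \<noteq> v"
  shows "\<exists>w. {v, w} \<in> E \<and> graph_connected V (insert {v, u} (E - {{v, w}}))"
proof -
  let ?E = "{(a, b). {a, b} \<in> E}"
  let ?A = "{(a, b). {a, b} \<in> E \<and> a \<noteq> v \<and> b \<noteq> v}"
  \<comment> \<open>Otherwise the vertices reachable from \<open>u\<close> without passing \<open>v\<close> would have no edge to \<open>v\<close>.\<close>
  have "\<exists>w. (u, w) \<in> ?A\<^sup>* \<and> {v, w} \<in> E"
  proof (rule ccontr)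
    assume no: "\<not> ?thesis"
    have "z \<noteq> v \<and> (u, z) \<in> ?A\<^sup>*" if "(u, z) \<in> ?E\<^sup>*" for z
      using that
    proof (induction rule: rtrancl_induct)
      case base show ?case using \<open>u \<noteq> v\<close> by simp
    next
      case (step y z)
      then have "z \<noteq> v" using no by (auto simp: insert_commute)
      then have "(y, z) \<in> ?A" using step by auto
      then show ?case using step \<open>z \<noteq> v\<close> by (meson rtrancl.rtrancl_into_rtrancl)
    qed
    then show False using assms by (auto simp: graph_connected_def)
  qed
  then obtain w where uw: "(u, w) \<in> ?A\<^sup>*" and vw: "{v, w} \<in> E" by blast
  let ?E' = "insert {v, u} (E - {{v, w}})"
  let ?R = "{(a, b). {a, b} \<in> ?E'}"
  have symR: "sym ?R" by (auto simp: sym_def insert_commute)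
  have "?A \<subseteq> ?R" by (auto simp: doubleton_eq_iff)
  then have "(u, w) \<in> ?R\<^sup>*" using uw rtrancl_mono by blast
  moreover have "(v, u) \<in> ?R" by simp
  ultimately have "(v, w) \<in> ?R\<^sup>*" by (rule converse_rtrancl_into_rtrancl[rotated])
  moreover from this have "(w, v) \<in> ?R\<^sup>*" by (rule symD[OF sym_rtrancl[OF symR]])
  ultimately have "?E \<subseteq> ?R\<^sup>*" by (auto simp: doubleton_eq_iff)
  then have "?E\<^sup>* \<subseteq> ?R\<^sup>*" by (rule rtrancl_subset_rtrancl)
  then have "graph_connected V ?E'" using conn unfolding graph_connected_def by blast
  then show ?thesis using vw by blast
qed

text \<open>
  A tree without the edge \<open>{v, u}\<close> would become strictly lighter by giving up another edge at \<open>v\<close> for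
  it. As the weights are nonnegative, pruning the exchanged graph to a spanning tree adds nothing.
\<close>

lemma nearest_neighbour_edge_in_mst:
  assumes mst: "minimum_spanning_tree w n E"
    and nonneg: "\<And>e. e \<in> complete_edges n \<Longrightarrow> 0 \<le> w e"
    and uv: "u \<in> {1..n}" "v \<in> {1..n}" "u \<noteq> v"
    and nearest: "\<And>y. y \<in> {1..n} \<Longrightarrow> y \<noteq> u \<Longrightarrow> y \<noteq> v \<Longrightarrow> w {v, u} < w {v, y}"
  shows "{v, u} \<in> E"
proof (rule ccontr)
  assume notin: "{v, u} \<notin> E"
  have sub: "E \<subseteq> complete_edges n" and conn: "graph_connected {1..n} E"
    and min: "\<And>F. spanning_tree n F \<Longrightarrow> sum w E \<le> sum w F"
    using mst by (auto simp: minimum_spanning_tree_def spanning_tree_def)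
  have fin: "finite E" using sub finite_complete_edges finite_subset by blast
  obtain y where y: "{v, y} \<in> E" and conn': "graph_connected {1..n} (insert {v, u} (E - {{v, y}}))"
    using connected_edge_exchange[OF conn uv] by blast
  let ?E' = "insert {v, u} (E - {{v, y}})"
  have sub': "?E' \<subseteq> complete_edges n" using sub uv by (auto simp: complete_edges_def)
  obtain F where F: "F \<subseteq> ?E'" "spanning_tree n F"
    using connected_contains_spanning_tree[OF sub' conn'] fin by auto
  have "y \<in> {1..n}" "y \<noteq> v" using y sub by (auto simp: complete_edges_def doubleton_eq_iff)
  then have less: "w {v, u} < w {v, y}" using nearest y notin by blast
  have "sum w F \<le> sum w ?E'" using F(1) fin nonneg sub' by (intro sum_mono2) auto
  also have "\<dots> = w {v, u} + sum w (E - {{v, y}})" using fin notin by (subst sum.insert) auto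
  also have "\<dots> < sum w E" using less sum.remove[OF fin y, of w] by simp
  finally show False using min[OF F(2)] by simp
qed

section \<open>The weight function and the configuration around a hub\<close>

definition two_colour_weight :: "real \<Rightarrow> real^2 \<Rightarrow> real^2 \<Rightarrow> real" where
  "two_colour_weight c x y = (if x $ 1 < 1/2 \<longleftrightarrow> y $ 1 < 1/2 then dist x y else c * dist x y)"

text \<open>
  The cells with index below \<open>K\<close> are for the leaves: horizontal strips of height \<open>r / (2 * K)\<close> stacked to
  the right of the dividing line, consecutive strips being separated by gaps of the same height. The
  cell with index \<open>K\<close> is for the hub; it stays away from the line so that it can be a closed rectangle
  and still have the other colour.
\<close>

definition cell :: "nat \<Rightarrow> real \<Rightarrow> nat \<Rightarrow> (real^2) set" where
  "cell K r j =
     (if j < K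
      then cbox (vector [1/2, 1/2 + real (2 * j) * (r / real (2 * K))])
                (vector [1/2 + r, 1/2 + real (2 * j + 1) * (r / real (2 * K))])
      else cbox (vector [1/2 - r, 1/2]) (vector [1/2 - r / 2, 1/2 + r]))"

definition window :: "real \<Rightarrow> (real^2) set" where
  "window r = cbox (vector [1/2 - 5 * r, 1/2 - 5 * r]) (vector [1/2 + 5 * r, 1/2 + 5 * r])"

lemma two_colour_weight_commute: "two_colour_weight c x y = two_colour_weight c y x"
  by (auto simp: two_colour_weight_def dist_commute)

lemma edge_weight_two_colour:
  assumes "i \<noteq> j"
  shows "edge_weight \<alpha> (two_colour_weight c) x {i, j} = two_colour_weight c (x i) (x j) powr \<alpha>"
  using assms
  by (cases "i < j") (auto simp: edge_weight_def min_def max_def two_colour_weight_commute)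

lemma edge_weight_function_two_colour:
  assumes "0 < c" "c \<le> 1"
  shows "edge_weight_function c 1 (two_colour_weight c)"
proof -
  have "(\<lambda>z::(real^2) \<times> (real^2). two_colour_weight c (fst z) (snd z)) \<in> borel_measurable borel"
    unfolding two_colour_weight_def borel_prod[symmetric] by measurable
  then have "(\<lambda>(x, y). two_colour_weight c x y)
      \<in> borel_measurable (restrict_space borel (unit_square \<times> unit_square))"
    by (simp add: case_prod_unfold measurable_restrict_space1)
  moreover have "c * dist x y \<le> dist x y" for x y :: "real^2"
    using assms by (simp add: mult_left_le_one_le)
  ultimately show ?thesis
    using assms two_colour_weight_commute
    by (auto simp: edge_weight_function_def two_colour_weight_def dist_commute)
qed

lemma mem_cell_leaf:
  assumes "j < K"
  shows "x \<in> cell K r j \<longleftrightarrow> 1/2 \<le> x $ 1 \<and> x $ 1 \<le> 1/2 + r \<and>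
    1/2 + real (2 * j) * (r / real (2 * K)) \<le> x $ 2 \<and>
    x $ 2 \<le> 1/2 + real (2 * j + 1) * (r / real (2 * K))"
  using assms by (auto simp: cell_def mem_box_cart forall_2)

lemma mem_cell_hub:
  "x \<in> cell K r K \<longleftrightarrow> 1/2 - r \<le> x $ 1 \<and> x $ 1 \<le> 1/2 - r/2 \<and> 1/2 \<le> x $ 2 \<and> x $ 2 \<le> 1/2 + r"
  by (auto simp: cell_def mem_box_cart forall_2)

lemma leaf_cell_bounds:
  assumes "j < K" "0 < r" "x \<in> cell K r j"
  shows "1/2 \<le> x $ 1" "x $ 1 \<le> 1/2 + r" "1/2 \<le> x $ 2" "x $ 2 \<le> 1/2 + r"
proof -
  have "real (2 * j + 1) * (r / real (2 * K)) \<le> real (2 * K) * (r / real (2 * K))"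
    using assms by (intro mult_right_mono) auto
  also have "\<dots> = r" using assms by simp
  finally have *: "real (2 * j + 1) * (r / real (2 * K)) \<le> r" .
  have **: "0 \<le> real (2 * j) * (r / real (2 * K))" using assms by simp
  show "1/2 \<le> x $ 1" "x $ 1 \<le> 1/2 + r" using assms(3) unfolding mem_cell_leaf[OF assms(1)] by blast+
  show "1/2 \<le> x $ 2" "x $ 2 \<le> 1/2 + r"
    using assms(3) * ** unfolding mem_cell_leaf[OF assms(1)] by linarith+
qed

lemma cell_subset_window:
  assumes "j \<le> K" "0 < r"
  shows "cell K r j \<subseteq> window r"
proof
  fix x assume x: "x \<in> cell K r j"
  show "x \<in> window r"
  proof (cases "j < K")
    case True
    then show ?thesis using leaf_cell_bounds[OF True assms(2) x] assms(2)
      by (auto simp: window_def mem_box_cart forall_2)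
  next
    case False
    then have "x \<in> cell K r K" using x assms by simp
    then show ?thesis using assms(2) unfolding mem_cell_hub
      by (auto simp: window_def mem_box_cart forall_2)
  qed
qed

text \<open>
  Leaf and hub differ by at most \<open>2 * r\<close> horizontally and \<open>r\<close> vertically, hence the weight function is
  at most \<open>3 * r * c\<close> on them. This is less than the separation \<open>r / (2 * K)\<close> of two leaves by the
  choice of \<open>c\<close>, and less than \<open>4 * r * c\<close>, a lower bound for its value on a leaf and a node outside the window:
  leaves have distance at most \<open>r\<close> in each coordinate from the centre of the window, nodes outside it
  more than \<open>5 * r\<close> in some coordinate. The strict inequality survives raising to the power \<open>\<alpha>\<close>.
\<close>

lemma hub_degree:
  assumes mst: "minimum_spanning_tree (edge_weight \<alpha> (two_colour_weight (1 / (8 * real K))) x) n E"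
    and pos: "0 < \<alpha>" "0 < K" "0 < r"
    and v: "v ` {..K} \<subseteq> {1..n}" "inj_on v {..K}"
    and cells: "\<And>j. j \<le> K \<Longrightarrow> x (v j) \<in> cell K r j"
    and others: "\<And>i. i \<in> {1..n} - v ` {..K} \<Longrightarrow> x i \<notin> window r"
  shows "K \<le> node_degree E (v K)"
proof -
  define c where "c = 1 / (8 * real K)"
  have c: "0 < c" and c1: "c \<le> 1" using pos by (simp_all add: c_def divide_simps)
  let ?h = "two_colour_weight c"
  have hub: "1/2 - r \<le> x (v K) $ 1" "x (v K) $ 1 \<le> 1/2 - r/2" "1/2 \<le> x (v K) $ 2" "x (v K) $ 2 \<le> 1/2 + r"
    using cells[of K] unfolding mem_cell_hub by auto
  have h_nonneg: "0 \<le> ?h y z" and h_lower: "c * dist y z \<le> ?h y z" for y z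
    using c c1 mult_left_le_one_le[of "dist y z" c] by (auto simp: two_colour_weight_def)
  have edge: "{v j, v K} \<in> E" if j: "j < K" for j
  proof (rule nearest_neighbour_edge_in_mst[OF mst])
    show "0 \<le> edge_weight \<alpha> (two_colour_weight (1 / (8 * real K))) x e" for e
      by (simp add: edge_weight_def)
    show "v K \<in> {1..n}" "v j \<in> {1..n}"
      using j by (intro subsetD[OF v(1)] imageI; simp)+
    show vne: "v K \<noteq> v j" using v(2) j by (auto simp: inj_on_eq_iff)
    fix y assume y: "y \<in> {1..n}" "y \<noteq> v K" "y \<noteq> v j"
    have leaf: "1/2 \<le> x (v j) $ 1" "x (v j) $ 1 \<le> 1/2 + r" "1/2 \<le> x (v j) $ 2" "x (v j) $ 2 \<le> 1/2 + r"
      using leaf_cell_bounds[OF j pos(3) cells[of j]] j by auto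
    have "dist (x (v j)) (x (v K)) \<le> \<bar>x (v j) $ 1 - x (v K) $ 1\<bar> + \<bar>x (v j) $ 2 - x (v K) $ 2\<bar>"
      using norm_le_l1_cart[of "x (v j) - x (v K)"] by (simp add: dist_norm sum_2)
    also have "\<dots> \<le> 3 * r" using leaf hub by linarith
    finally have near: "?h (x (v j)) (x (v K)) \<le> c * (3 * r)"
      using leaf hub pos c by (auto simp: two_colour_weight_def)
    have far: "c * (3 * r) < ?h (x (v j)) (x y)"
    proof (cases "y \<in> v ` {..K}")
      case True
      then obtain i where i: "y = v i" "i < K" "i \<noteq> j" using y by (metis atMost_iff image_iff le_neq_implies_less)
      let ?t = "r / real (2 * K)"
      have t: "0 < ?t" using pos by simp
      have leaf': "1/2 \<le> x (v i) $ 1" using leaf_cell_bounds(1)[OF i(2) pos(3) cells[of i]] i by auto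
      have i2: "1/2 + real (2 * i) * ?t \<le> x (v i) $ 2" "x (v i) $ 2 \<le> 1/2 + real (2 * i + 1) * ?t"
        using cells[of i] i(2) unfolding mem_cell_leaf[OF i(2)] by auto
      have j2: "1/2 + real (2 * j) * ?t \<le> x (v j) $ 2" "x (v j) $ 2 \<le> 1/2 + real (2 * j + 1) * ?t"
        using cells[of j] j unfolding mem_cell_leaf[OF j] by auto
      \<comment> \<open>Distinct strips are separated by a full gap.\<close>
      have gap: "real (2 * a + 1) * ?t + ?t \<le> real (2 * b) * ?t" if "a < b" for a b
      proof -
        have "real (2 * a + 1) * ?t + ?t = real (2 * a + 2) * ?t" by (simp add: algebra_simps add_divide_distrib)
        also have "\<dots> \<le> real (2 * b) * ?t" using t that by (intro mult_right_mono) auto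
        finally show ?thesis .
      qed
      have "?t \<le> \<bar>x (v j) $ 2 - x (v i) $ 2\<bar>"
        using i(3) gap[of i j] gap[of j i] i2 j2 by (cases "i < j") linarith+
      also have "\<dots> \<le> dist (x (v j)) (x (v i))"
        using dist_vec_nth_le[of "x (v j)" 2 "x (v i)"] by (simp add: dist_real_def)
      finally have "?t \<le> ?h (x (v j)) (x y)" using leaf leaf' i(1) by (simp add: two_colour_weight_def)
      moreover have "c * (3 * r) < ?t" using pos by (simp add: c_def field_simps)
      ultimately show ?thesis by linarith
    next
      case False
      then have "x y \<notin> window r" using others y by auto
      then have "4 * r < \<bar>x (v j) $ 1 - x y $ 1\<bar> \<or> 4 * r < \<bar>x (v j) $ 2 - x y $ 2\<bar>"
        using leaf by (auto simp: window_def mem_box_cart forall_2)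
      then have "4 * r < dist (x (v j)) (x y)"
        using dist_vec_nth_le[of "x (v j)" 1 "x y"] dist_vec_nth_le[of "x (v j)" 2 "x y"]
        by (auto simp: dist_real_def)
      then have "c * (4 * r) < c * dist (x (v j)) (x y)" using c by simp
      moreover have "c * (3 * r) \<le> c * (4 * r)" using c pos by simp
      ultimately show ?thesis using h_lower[of "x (v j)" "x y"] by linarith
    qed
    have "?h (x (v j)) (x (v K)) powr \<alpha> < ?h (x (v j)) (x y) powr \<alpha>"
      using near far h_nonneg pos by (intro powr_less_mono2) auto
    then show "edge_weight \<alpha> (two_colour_weight (1 / (8 * real K))) x {v j, v K}
        < edge_weight \<alpha> (two_colour_weight (1 / (8 * real K))) x {v j, y}"
      using vne y unfolding c_def by (subst (1 2) edge_weight_two_colour) auto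
  qed
  have fin: "finite {e \<in> E. v K \<in> e}"
    using mst finite_complete_edges[of n] finite_subset
    by (fastforce simp: minimum_spanning_tree_def spanning_tree_def)
  have "inj_on (\<lambda>j. {v j, v K}) {..<K}"
    using v(2) by (auto simp: inj_on_def doubleton_eq_iff)
  then have "K = card ((\<lambda>j. {v j, v K}) ` {..<K})" by (simp add: card_image)
  also have "\<dots> \<le> node_degree E (v K)"
    unfolding node_degree_def by (rule card_mono[OF fin]) (use edge in auto)
  finally show ?thesis .
qed

section \<open>The probability of the configuration\<close>

lemma rectangle_area:
  fixes a b c d :: real
  assumes "a \<le> c" "b \<le> d"
  shows "measure lborel (cbox (vector [a, b] :: real^2) (vector [c, d])) = (c - a) * (d - b)"
proof -
  have "vector [a, b] \<in> cbox (vector [a, b] :: real^2) (vector [c, d])"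
    using assms by (simp add: mem_box_cart forall_2)
  then show ?thesis by (subst content_cbox_cart) (auto simp: UNIV_2)
qed

text \<open>
  The hub cell has area \<open>r\<^sup>2 / 2\<close> and a leaf cell has area \<open>r\<^sup>2 / (2 * K)\<close>; the bound covers both.
\<close>

lemma cell_area:
  assumes "j \<le> K" "0 < K" "0 < r"
  shows "r\<^sup>2 / (4 * real K) \<le> measure lborel (cell K r j)"
proof (cases "j < K")
  case True
  let ?t = "r / real (2 * K)"
  have "real (2 * j) * ?t \<le> real (2 * j + 1) * ?t" using assms by (intro mult_right_mono) auto
  then have "measure lborel (cell K r j) = r * (real (2 * j + 1) * ?t - real (2 * j) * ?t)"
    using True assms unfolding cell_def by (simp add: rectangle_area)
  also have "real (2 * j + 1) * ?t - real (2 * j) * ?t = ?t"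
    by (simp add: algebra_simps add_divide_distrib)
  finally have "measure lborel (cell K r j) = r\<^sup>2 / (2 * real K)"
    by (simp add: power2_eq_square)
  moreover have "r\<^sup>2 / (4 * real K) \<le> r\<^sup>2 / (2 * real K)"
    using assms by (intro divide_left_mono) auto
  ultimately show ?thesis by simp
next
  case False
  then have "measure lborel (cell K r j) = (r / 2) * r"
    using assms unfolding cell_def by (simp add: rectangle_area)
  moreover have "r\<^sup>2 / (4 * real K) \<le> r\<^sup>2 / 2" using assms by (intro divide_left_mono) auto
  ultimately show ?thesis by (simp add: power2_eq_square)
qed

lemma window_area:
  assumes "0 < r"
  shows "measure lborel (window r) = 100 * r\<^sup>2"
  using assms by (simp add: window_def rectangle_area power2_eq_square)

lemma distributed_prob_bounds:
  fixes Y :: "'a \<Rightarrow> 'b::euclidean_space"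
  assumes "prob_space M"
    and dens: "distributed M (restrict_space lborel S) Y (\<lambda>x. ennreal (f x))"
    and S: "S \<in> sets lborel"
    and "0 \<le> a"
    and f: "\<And>x. x \<in> S \<Longrightarrow> a \<le> f x \<and> f x \<le> b"
    and A: "A \<in> sets lborel" "A \<subseteq> S" "bounded A"
  shows "a * measure lborel A \<le> measure M (Y -` A \<inter> space M)"
    and "measure M (Y -` A \<inter> space M) \<le> b * measure lborel A"
proof -
  interpret prob_space M by fact
  let ?N = "restrict_space lborel S"
  have AN: "A \<in> sets ?N" using A S by (auto simp: sets_restrict_space_iff)
  have area: "emeasure ?N A = ennreal (measure lborel A)"
    using emeasure_bounded_finite[OF A(3)] S A(2)
    by (subst emeasure_restrict_space) (auto intro!: emeasure_eq_ennreal_measure)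
  have P: "emeasure M (Y -` A \<inter> space M) = (\<integral>\<^sup>+x. ennreal (f x) * indicator A x \<partial>?N)"
    by (rule distributed_emeasure[OF dens AN])
  have "ennreal (a * measure lborel A) = (\<integral>\<^sup>+x. ennreal a * indicator A x \<partial>?N)"
    using AN \<open>0 \<le> a\<close> by (simp add: nn_integral_cmult_indicator area ennreal_mult)
  also have "\<dots> \<le> emeasure M (Y -` A \<inter> space M)"
    unfolding P using f A(2) by (intro nn_integral_mono) (auto simp: indicator_def intro!: ennreal_leI)
  finally show "a * measure lborel A \<le> measure M (Y -` A \<inter> space M)"
    by (simp add: emeasure_eq_measure)
  show "measure M (Y -` A \<inter> space M) \<le> b * measure lborel A"
  proof (cases "A = {}")
    case False
    then have "0 \<le> b" using f A(2) \<open>0 \<le> a\<close> by fastforce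
    have "emeasure M (Y -` A \<inter> space M) \<le> (\<integral>\<^sup>+x. ennreal b * indicator A x \<partial>?N)"
      unfolding P using f A(2) by (intro nn_integral_mono) (auto simp: indicator_def intro!: ennreal_leI)
    also have "\<dots> = ennreal (b * measure lborel A)"
      using AN \<open>0 \<le> b\<close> by (simp add: nn_integral_cmult_indicator area ennreal_mult)
    finally show ?thesis using \<open>0 \<le> b\<close> by (simp add: emeasure_eq_measure)
  qed simp
qed

text \<open>
  The indices are cut into \<open>K + 1\<close> blocks of length \<open>m\<close>, and block \<open>j\<close> has to provide the point in the
  cell \<open>C j\<close>. For each of the \<open>m ^ (K + 1)\<close> ways \<open>\<phi>\<close> to choose one index per block there is the event
  that the chosen points lie in their cells and all other points avoid \<open>W\<close>. By independence it has
  probability at least \<open>p ^ (K + 1) * (1 - q) ^ n\<close>. The events for different choices are disjoint,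
  because \<open>\<phi>\<close> can be recovered from the set of points in \<open>W\<close>; so their probabilities add up.
  The blocks lose only a constant factor against counting all injections of cells into indices.
\<close>

lemma (in prob_space) prob_one_point_per_cell:
  assumes indep: "indep_vars (\<lambda>_. N) X {1..}"
    and C: "\<And>j. j \<le> K \<Longrightarrow> C j \<in> sets N" "\<And>j. j \<le> K \<Longrightarrow> C j \<subseteq> W" and W: "W \<in> sets N"
    and p: "\<And>i j. 1 \<le> i \<Longrightarrow> j \<le> K \<Longrightarrow> p \<le> prob (X i -` C j \<inter> space M)" "0 \<le> p"
    and q: "\<And>i. 1 \<le> i \<Longrightarrow> prob (X i -` W \<inter> space M) \<le> q" "0 \<le> q" "q \<le> 1"
    and "0 < m"
  defines "n \<equiv> (K + 1) * m"
  obtains G where "G \<in> events" "(real m * p) ^ (K + 1) * (1 - q) ^ n \<le> prob G"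
    "\<And>\<omega>. \<omega> \<in> G \<Longrightarrow> \<exists>v. v ` {..K} \<subseteq> {1..n} \<and> inj_on v {..K} \<and> (\<forall>j\<le>K. X (v j) \<omega> \<in> C j) \<and>
      (\<forall>i\<in>{1..n} - v ` {..K}. X i \<omega> \<notin> W)"
proof -
  \<comment> \<open>\<open>v \<phi> j\<close> is the index chosen in block \<open>j\<close>; the summand 1 is there because points are numbered from 1.
      \<open>A \<phi> i\<close> is the set in which the point with index \<open>i\<close> has to lie under the choice \<open>\<phi>\<close>.\<close>
  define v where "v \<phi> j = j * m + \<phi> j + 1" for \<phi> :: "nat \<Rightarrow> nat" and j
  define A where "A \<phi> i = (let j = (i - 1) div m in if i = v \<phi> j then C j else space N - W)" for \<phi> i
  define E where "E \<phi> = (\<Inter>i\<in>{1..n}. X i -` A \<phi> i \<inter> space M)" for \<phi>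
  let ?\<Phi> = "{..K} \<rightarrow>\<^sub>E {..<m}"
  have n: "1 \<le> n" using \<open>0 < m\<close> by (simp add: n_def)
  have block: "(i - 1) div m \<le> K" if "i \<in> {1..n}" for i
  proof -
    have "i - 1 < (K + 1) * m" using that n_def by auto
    then have "(i - 1) div m < K + 1" by (simp add: less_mult_imp_div_less)
    then show ?thesis by simp
  qed
  have \<phi>_less: "\<phi> j < m" if "\<phi> \<in> ?\<Phi>" "j \<le> K" for \<phi> j using that by (auto simp: PiE_iff)
  have v_div: "(v \<phi> j - 1) div m = j" if "\<phi> \<in> ?\<Phi>" "j \<le> K" for \<phi> j
    using \<phi>_less[OF that] by (simp add: v_def)
  have v_range: "v \<phi> j \<in> {1..n}" if "\<phi> \<in> ?\<Phi>" "j \<le> K" for \<phi> j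
  proof -
    have "v \<phi> j \<le> j * m + m" using \<phi>_less[OF that] by (simp add: v_def)
    also have "\<dots> = (j + 1) * m" by simp
    also have "\<dots> \<le> n" unfolding n_def using that by (intro mult_right_mono) auto
    finally show ?thesis by (simp add: v_def)
  qed
  have v_inj: "inj_on (v \<phi>) {..K}" if "\<phi> \<in> ?\<Phi>" for \<phi>
    using v_div[OF that] by (intro inj_onI) (metis atMost_iff)
  have A_v: "A \<phi> (v \<psi> j) = (if \<phi> j = \<psi> j then C j else space N - W)"
    if "\<phi> \<in> ?\<Phi>" "\<psi> \<in> ?\<Phi>" "j \<le> K" for \<phi> \<psi> j
    using v_div[OF that(2,3)] by (auto simp: A_def Let_def v_def)
  have A_other: "A \<phi> i = space N - W" if "i \<in> {1..n} - v \<phi> ` {..K}" for \<phi> i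
    using block[of i] that by (auto simp: A_def Let_def)
  have A_sets: "A \<phi> i \<in> sets N" if "i \<in> {1..n}" for \<phi> i
    using C(1) W block[OF that] by (auto simp: A_def Let_def)
  have rv: "X i \<in> measurable M N" if "1 \<le> i" for i
    using indep that by (auto simp: indep_vars_def)
  have E_sets: "E \<phi> \<in> events" for \<phi>
    unfolding E_def using n by (intro sets.finite_INT measurable_sets[OF rv A_sets]) auto
  have E_prob: "p ^ (K + 1) * (1 - q) ^ n \<le> prob (E \<phi>)" if \<phi>: "\<phi> \<in> ?\<Phi>" for \<phi>
  proof -
    let ?V = "v \<phi> ` {..K}"
    have V: "?V \<subseteq> {1..n}" using v_range[OF \<phi>] by auto
    have cV: "card ?V = K + 1" using card_image[OF v_inj[OF \<phi>]] by simp
    have "p ^ (K + 1) * (1 - q) ^ n \<le> p ^ card ?V * (1 - q) ^ card ({1..n} - ?V)"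
      unfolding cV using p q card_mono[of "{1..n}" "{1..n} - ?V"]
      by (intro mult_left_mono power_decreasing) auto
    also have "\<dots> = (\<Prod>i\<in>{1..n}. if i \<in> ?V then p else 1 - q)"
      using V by (subst prod.If_cases) (auto simp: Int_absorb1 Diff_eq)
    also have "\<dots> \<le> (\<Prod>i\<in>{1..n}. prob (X i -` A \<phi> i \<inter> space M))"
    proof (intro prod_mono conjI)
      fix i assume i: "i \<in> {1..n}"
      show "0 \<le> (if i \<in> ?V then p else 1 - q)" using p q by simp
      show "(if i \<in> ?V then p else 1 - q) \<le> prob (X i -` A \<phi> i \<inter> space M)"
      proof (cases "i \<in> ?V")
        case True
        then obtain j where "j \<le> K" "i = v \<phi> j" by auto
        then show ?thesis using p(1)[of i j] A_v[OF \<phi> \<phi>] True i by auto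
      next
        case False
        have "X i -` A \<phi> i \<inter> space M = space M - (X i -` W \<inter> space M)"
          using A_other[of i \<phi>] False i measurable_space[OF rv, of i] by auto
        then show ?thesis
          using False i q(1)[of i] prob_compl[OF measurable_sets[OF rv W], of i] by simp
      qed
    qed
    also have "\<dots> = prob (E \<phi>)"
      unfolding E_def using n A_sets by (intro indep_varsD[OF indep, symmetric]) auto
    finally show ?thesis .
  qed
  have disj: "disjoint_family_on E ?\<Phi>"
    unfolding disjoint_family_on_def
  proof (intro ballI impI)
    fix \<phi> \<psi> assume *: "\<phi> \<in> ?\<Phi>" "\<psi> \<in> ?\<Phi>" "\<phi> \<noteq> \<psi>"
    then obtain j where j: "j \<le> K" "\<phi> j \<noteq> \<psi> j" by (metis PiE_ext atMost_iff)
    \<comment> \<open>The point \<open>v \<phi> j\<close> is required inside \<open>W\<close> by \<open>\<phi>\<close> and outside \<open>W\<close> by \<open>\<psi>\<close>.\<close>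
    then have "A \<phi> (v \<phi> j) \<inter> A \<psi> (v \<phi> j) = {}" using A_v[OF *(1,1)] A_v[OF *(2,1)] C(2)[OF j(1)] by auto
    then show "E \<phi> \<inter> E \<psi> = {}" using v_range[OF *(1) j(1)] unfolding E_def by blast
  qed
  have fin: "finite ?\<Phi>" by (intro finite_PiE) auto
  have "(real m * p) ^ (K + 1) * (1 - q) ^ n = real (card ?\<Phi>) * (p ^ (K + 1) * (1 - q) ^ n)"
    by (simp add: card_PiE power_mult_distrib)
  also have "\<dots> \<le> (\<Sum>\<phi>\<in>?\<Phi>. prob (E \<phi>))"
    using E_prob by (intro sum_bounded_below) auto
  also have "\<dots> = prob (\<Union>(E ` ?\<Phi>))"
    using E_sets fin disj by (intro finite_measure_finite_Union[symmetric]) auto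
  finally have "(real m * p) ^ (K + 1) * (1 - q) ^ n \<le> prob (\<Union>(E ` ?\<Phi>))" .
  moreover have "\<Union>(E ` ?\<Phi>) \<in> events" using E_sets fin by auto
  moreover have "\<exists>v. v ` {..K} \<subseteq> {1..n} \<and> inj_on v {..K} \<and> (\<forall>j\<le>K. X (v j) \<omega> \<in> C j) \<and>
      (\<forall>i\<in>{1..n} - v ` {..K}. X i \<omega> \<notin> W)" if \<omega>: "\<omega> \<in> \<Union>(E ` ?\<Phi>)" for \<omega>
  proof -
    obtain \<phi> where \<phi>: "\<phi> \<in> ?\<Phi>" and "\<omega> \<in> E \<phi>" using \<omega> by blast
    then have mem: "X i \<omega> \<in> A \<phi> i" if "i \<in> {1..n}" for i using that by (auto simp: E_def)
    show ?thesis
    proof (intro exI[of _ "v \<phi>"] conjI ballI allI impI)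
      show "v \<phi> ` {..K} \<subseteq> {1..n}" using v_range[OF \<phi>] by blast
      show "inj_on (v \<phi>) {..K}" by (rule v_inj[OF \<phi>])
      show "X (v \<phi> j) \<omega> \<in> C j" if "j \<le> K" for j
        using mem[OF v_range[OF \<phi> that]] A_v[OF \<phi> \<phi> that] by simp
      show "X i \<omega> \<notin> W" if "i \<in> {1..n} - v \<phi> ` {..K}" for i
        using mem[of i] A_other[OF that] that by simp
    qed
  qed
  ultimately show thesis using that by blast
qed

section \<open>Unbounded degrees with positive probability\<close>

lemma unit_square_eq_cbox: "unit_square = cbox 0 1"
  by (auto simp: unit_square_def mem_box_cart)

lemma window_subset_unit_square:
  assumes "r \<le> 1/10"
  shows "window r \<subseteq> unit_square"
  using assms by (auto simp: window_def unit_square_def mem_box_cart forall_2)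

lemma sets_restrict_unit_square:
  "A \<in> sets (restrict_space borel unit_square) \<longleftrightarrow> A \<in> sets borel \<and> A \<subseteq> unit_square"
  by (subst sets_restrict_space_iff) (auto simp: unit_square_eq_cbox)

theorem proposition1:
  fixes M :: "'a measure"
    and X :: "nat \<Rightarrow> 'a \<Rightarrow> real^2"
    and f :: "real^2 \<Rightarrow> real"
    and T :: "(real^2 \<Rightarrow> real^2 \<Rightarrow> real) \<Rightarrow> nat \<Rightarrow> (nat \<Rightarrow> real^2) \<Rightarrow> nat set set"
    and \<alpha> \<epsilon>1 \<epsilon>2 :: real
    and K :: nat
  assumes "prob_space M"
    and "0 < \<epsilon>1" and "\<epsilon>1 \<le> \<epsilon>2"
    and "\<And>x. x \<in> unit_square \<Longrightarrow> \<epsilon>1 \<le> f x \<and> f x \<le> \<epsilon>2"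
    and "\<And>i. 1 \<le> i \<Longrightarrow>
           distributed M (restrict_space lborel unit_square) (X i) (\<lambda>x. ennreal (f x))"
    and "prob_space.indep_vars M (\<lambda>_. restrict_space borel unit_square) X {1..}"
    and "0 < \<alpha>"
    and "mst_rule \<alpha> T"
    and "2 \<le> K"
  shows "\<exists>h. (\<exists>c1 c2. 0 < c1 \<and> 0 < c2 \<and> edge_weight_function c1 c2 h) \<and>
           (\<exists>(n :: nat \<Rightarrow> nat) \<epsilon>0 :: real.
              (\<forall>l\<ge>1. 0 < n l) \<and> filterlim n at_top sequentially \<and> 0 < \<epsilon>0 \<and>
              (\<forall>l\<ge>1. \<epsilon>0 \<le> measure M {\<omega> \<in> space M.
                 K \<le> Max ((\<lambda>i. node_degree (T h (n l) (\<lambda>i\<in>{1..n l}. X i \<omega>)) i) ` {1..n l})}))"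
proof -
  interpret prob_space M by fact
  let ?S = "restrict_space borel unit_square :: (real^2) measure"
  define c where "c = 1 / (8 * real K)"
  define h where "h = two_colour_weight c"
  define n where "n l = (K + 1) * l" for l
  \<comment> \<open>With \<open>r\<^sup>2 = 1 / (D * l)\<close> the expected number of nodes in the window, at most
      \<open>n l * \<epsilon>2 * 100 * r\<^sup>2\<close>, is below \<open>1/2\<close>, and the window fits into the square for all \<open>l \<ge> 1\<close>.\<close>
  define D where "D = 200 * (\<epsilon>2 + 1) * (real K + 1)"
  define \<epsilon>0 where "\<epsilon>0 = (\<epsilon>1 / (4 * real K * D)) ^ (K + 1) / 2"
  have K: "0 < K" and \<epsilon>2: "0 < \<epsilon>2" using assms by auto
  have c: "0 < c" "c \<le> 1" using K by (simp_all add: c_def divide_simps)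
  have ewf: "edge_weight_function c 1 h"
    unfolding h_def using c by (rule edge_weight_function_two_colour)
  have "200 * 1 * 1 \<le> D" unfolding D_def using \<epsilon>2 by (intro mult_mono) auto
  then have D: "200 \<le> D" by simp
  have \<epsilon>0: "0 < \<epsilon>0" using assms(2) K D by (simp add: \<epsilon>0_def)
  have n_lim: "filterlim n at_top sequentially"
    unfolding n_def by (rule filterlim_subseq) (simp add: strict_mono_def add_less_le_mono)
  have "\<epsilon>0 \<le> prob {\<omega> \<in> space M.
      K \<le> Max ((\<lambda>i. node_degree (T h (n l) (\<lambda>i\<in>{1..n l}. X i \<omega>)) i) ` {1..n l})}"
    (is "_ \<le> prob ?B") if l: "1 \<le> l" for l
  proof -
    define r where "r = sqrt (1 / (D * real l))"
    have r: "0 < r" and r2: "r\<^sup>2 = 1 / (D * real l)" using D l by (simp_all add: r_def)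
    have "100 * 1 \<le> D * real l" using D l by (intro mult_mono) auto
    then have "r\<^sup>2 \<le> (1/10)\<^sup>2" unfolding r2 using D l by (simp add: field_simps power2_eq_square)
    then have "r \<le> 1/10" by (rule power2_le_imp_le) simp
    then have W: "window r \<subseteq> unit_square" by (rule window_subset_unit_square)
    have Cs: "cell K r j \<subseteq> unit_square" if "j \<le> K" for j
      using cell_subset_window[OF that r] W by blast
    have sets: "cell K r j \<in> sets borel" "window r \<in> sets borel"
      "bounded (cell K r j)" "bounded (window r)" for j
      by (auto simp: cell_def window_def bounded_cbox)
    have S: "unit_square \<in> sets lborel" by (simp add: unit_square_eq_cbox)
    define p where "p = \<epsilon>1 * (r\<^sup>2 / (4 * real K))"
    define q where "q = \<epsilon>2 * (100 * r\<^sup>2)"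
    note bounds = distributed_prob_bounds[OF \<open>prob_space M\<close> assms(5) S less_imp_le[OF assms(2)] assms(4)]
    have p: "p \<le> prob (X i -` cell K r j \<inter> space M)" if "1 \<le> i" "j \<le> K" for i j
    proof -
      have "p \<le> \<epsilon>1 * measure lborel (cell K r j)"
        unfolding p_def using assms(2) cell_area[OF that(2) K r] by (intro mult_left_mono) auto
      then show ?thesis using bounds(1)[OF that(1) _ _ Cs[OF that(2)]] sets by fastforce
    qed
    have q: "prob (X i -` window r \<inter> space M) \<le> q" if "1 \<le> i" for i
      using bounds(2)[OF that _ _ W] sets unfolding q_def window_area[OF r] by fastforce
    \<comment> \<open>The product \<open>l * p\<close> is a constant: this is where the choice of the scale enters.\<close>
    have lp: "real l * p = \<epsilon>1 / (4 * real K * D)" using l by (simp add: p_def r2)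
    have "real (n l) * q = \<epsilon>2 / (2 * (\<epsilon>2 + 1))"
      using l \<epsilon>2 by (simp add: q_def r2 n_def D_def divide_simps) (simp add: algebra_simps)
    also have "\<dots> \<le> 1/2" using \<epsilon>2 by (simp add: divide_simps)
    finally have nq: "real (n l) * q \<le> 1/2" .
    have q0: "0 \<le> q" using \<epsilon>2 by (simp add: q_def)
    have "1 \<le> n l" using l by (simp add: n_def)
    then have "1 * q \<le> real (n l) * q" using q0 by (intro mult_right_mono) auto
    then have q1: "q \<le> 1" using nq by linarith
    have "1/2 \<le> 1 + real (n l) * (- q)" using nq by simp
    also have "\<dots> \<le> (1 - q) ^ n l" using Bernoulli_inequality[of "- q" "n l"] q1 by simp
    finally have half: "1/2 \<le> (1 - q) ^ n l" .
    have p0: "0 \<le> p" using assms(2) by (simp add: p_def)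
    have "0 < l" using l by simp
    obtain G where G: "G \<in> events" "(real l * p) ^ (K + 1) * (1 - q) ^ n l \<le> prob G"
      "\<And>\<omega>. \<omega> \<in> G \<Longrightarrow> \<exists>v. v ` {..K} \<subseteq> {1..n l} \<and> inj_on v {..K} \<and>
        (\<forall>j\<le>K. X (v j) \<omega> \<in> cell K r j) \<and> (\<forall>i\<in>{1..n l} - v ` {..K}. X i \<omega> \<notin> window r)"
    proof (rule prob_one_point_per_cell[where K = K and C = "cell K r" and W = "window r" and p = p
          and q = q and m = l, OF assms(6)])
      show "cell K r j \<in> sets ?S" if "j \<le> K" for j
        using Cs[OF that] sets by (simp add: sets_restrict_unit_square)
      show "cell K r j \<subseteq> window r" if "j \<le> K" for j
        by (rule cell_subset_window[OF that r])
      show "window r \<in> sets ?S" using W sets by (simp add: sets_restrict_unit_square)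
    qed (use p p0 q q0 q1 \<open>0 < l\<close> in \<open>simp_all add: n_def\<close>)
    have rv: "X i \<in> measurable M ?S" if "1 \<le> i" for i
      using assms(6) that by (auto simp: indep_vars_def)
    have T: "T h (n l) \<in> measurable (PiM {1..n l} (\<lambda>_. ?S)) (count_space UNIV)"
      and mst: "\<And>x. x \<in> {1..n l} \<rightarrow>\<^sub>E unit_square \<Longrightarrow>
        minimum_spanning_tree (edge_weight \<alpha> h x) (n l) (T h (n l) x)"
      using assms(8) ewf c \<open>1 \<le> n l\<close> unfolding mst_rule_def by (meson zero_less_one)+
    have "(\<lambda>\<omega>. \<lambda>i\<in>{1..n l}. X i \<omega>) \<in> measurable M (PiM {1..n l} (\<lambda>_. ?S))"
      using rv by (intro measurable_restrict) auto
    \<comment> \<open>A non-measurable set would have measure 0, so the event itself must be measurable for its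
        measure to dominate that of \<open>G\<close>.\<close>
    from measurable_compose[OF this T]
    have "(\<lambda>\<omega>. T h (n l) (\<lambda>i\<in>{1..n l}. X i \<omega>)) -`
        {E. K \<le> Max ((\<lambda>i. node_degree E i) ` {1..n l})} \<inter> space M \<in> events"
      by (rule measurable_sets) simp
    then have B: "?B \<in> events" by (simp add: vimage_def Int_def conj_commute)
    have "G \<subseteq> ?B"
    proof
      fix \<omega> assume \<omega>: "\<omega> \<in> G"
      then have space: "\<omega> \<in> space M" using G(1) sets.sets_into_space by blast
      obtain v where v: "v ` {..K} \<subseteq> {1..n l}" "inj_on v {..K}"
        "\<And>j. j \<le> K \<Longrightarrow> X (v j) \<omega> \<in> cell K r j"
        "\<And>i. i \<in> {1..n l} - v ` {..K} \<Longrightarrow> X i \<omega> \<notin> window r"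
        using G(3)[OF \<omega>] by blast
      let ?x = "\<lambda>i\<in>{1..n l}. X i \<omega>"
      have vn: "v j \<in> {1..n l}" if "j \<le> K" for j using v(1) that by blast
      have "?x \<in> {1..n l} \<rightarrow>\<^sub>E unit_square"
        using measurable_space[OF rv space] by (auto simp: space_restrict_space)
      then have tree: "minimum_spanning_tree
          (edge_weight \<alpha> (two_colour_weight (1 / (8 * real K))) ?x) (n l) (T h (n l) ?x)"
        using mst unfolding h_def c_def by blast
      have "K \<le> node_degree (T h (n l) ?x) (v K)"
        using v(3,4) vn by (intro hub_degree[OF tree assms(7) K r v(1,2)]) auto
      also have "\<dots> \<le> Max ((\<lambda>i. node_degree (T h (n l) ?x) i) ` {1..n l})"
        using vn[of K] by (intro Max_ge) auto
      finally show "\<omega> \<in> ?B" using space by simp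
    qed
    then have "prob G \<le> prob ?B" using B by (intro finite_measure_mono)
    moreover have "\<epsilon>0 \<le> (real l * p) ^ (K + 1) * (1 - q) ^ n l"
      using mult_left_mono[OF half, of "(real l * p) ^ (K + 1)"] p0 unfolding \<epsilon>0_def lp[symmetric]
      by simp
    ultimately show ?thesis using G(2) by linarith
  qed
  moreover have "\<forall>l\<ge>1. 0 < n l" by (simp add: n_def)
  ultimately show ?thesis using ewf c n_lim \<epsilon>0 by (meson zero_less_one)
qed

end
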